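(* Let $ABC$ be an isosceles (and not equilateral) triangle with base angles $\alpha$. Suppose $ABC$ is tiled by a tile with angles $(\alpha,\beta,2\pi/3)$, where $\alpha$ is not a rational multiple of $\pi$. Then the tile is rational; that is, the ratios of its side lengths are rational.
   Context: A tiling of a triangle $ABC$ by a triangle $T$ (the tile) is a finite set of triangles congruent to $T$ (reflections allowed) whose interiors are pairwise disjoint and whose union is $ABC$ (tiles need not meet edge to edge). The base angles are the two equal angles of $ABC$. *)

theory Defs
  imports "HOL-Analysis.Analysis"
begin

text \<open>The type \<^typ>\<open>complex\<close> serves as the Euclidean plane. A triangle is given by three
  non-collinear vertices; as a point set it is the (closed, filled) convex hull of its vertices.\<close>

definition is_triangle :: "complex \<Rightarrow> complex \<Rightarrow> complex \<Rightarrow> bool" where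
  "is_triangle a b c \<longleftrightarrow> \<not> collinear {a, b, c}"

text \<open>Unoriented angle at the middle argument \<open>b\<close>, in radians, with values in \<open>[0, \<pi>]\<close>;
  only meaningful for \<open>a \<noteq> b\<close> and \<open>c \<noteq> b\<close>.\<close>

definition angle :: "complex \<Rightarrow> complex \<Rightarrow> complex \<Rightarrow> real" where
  "angle a b c = arccos (((a - b) \<bullet> (c - b)) / (norm (a - b) * norm (c - b)))"

definition equilateral :: "complex \<Rightarrow> complex \<Rightarrow> complex \<Rightarrow> bool" where
  "equilateral a b c \<longleftrightarrow> dist a b = dist b c \<and> dist b c = dist c a"

text \<open>Distance-preserving maps of the plane include the orientation-reversing ones,
  so tiles may be reflected.\<close>

definition congruent_figures :: "complex set \<Rightarrow> complex set \<Rightarrow> bool" where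
  "congruent_figures S T \<longleftrightarrow>
     (\<exists>f :: complex \<Rightarrow> complex. (\<forall>x y. dist (f x) (f y) = dist x y) \<and> f ` S = T)"

definition tiling :: "complex set set \<Rightarrow> complex set \<Rightarrow> complex set \<Rightarrow> bool" where
  "tiling \<T> T S \<longleftrightarrow>
     finite \<T> \<and>
     (\<forall>t\<in>\<T>. congruent_figures T t) \<and>
     pairwise (\<lambda>s t. interior s \<inter> interior t = {}) \<T> \<and>
     \<Union>\<T> = S"

definition side_lengths :: "complex \<Rightarrow> complex \<Rightarrow> complex \<Rightarrow> real set" where
  "side_lengths a b c = {dist a b, dist b c, dist c a}"

definition rational_triangle :: "complex \<Rightarrow> complex \<Rightarrow> complex \<Rightarrow> bool" where
  "rational_triangle a b c \<longleftrightarrow>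
     (\<forall>x\<in>side_lengths a b c. \<forall>y\<in>side_lengths a b c. x / y \<in> \<rat>)"

end

theory Submission
  imports Defs
begin

text \<open>
  Write \<open>a\<close>, \<open>b\<close>, \<open>c\<close> for the sides of the tile opposite \<open>\<alpha>\<close>, \<open>\<beta>\<close>, \<open>2\<pi>/3\<close>, and \<open>X\<close>, \<open>Y\<close> for the leg
  and the base of \<open>ABC\<close>. The idea is to weigh the edges of a tiling by signs that depend only on
  their directions. Let \<open>\<psi>\<close> be a function of a plane vector with \<open>\<psi> (x z) = x \<psi> z\<close> for real \<open>x\<close>; in
  particular \<open>\<psi>\<close> is odd. Sum \<open>\<psi>\<close> over the sides of a triangle traversed counterclockwise. If a
  triangle is tiled by triangles, the sums for the tiles add up to the sum for the whole
  (\<open>homogeneous_edge_sum_additive\<close>), because along an interior line the edges on the two sides are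
  traversed in opposite directions. The tiles need not meet edge to edge, and \<open>\<psi>\<close> may be
  discontinuous.

  As \<open>\<alpha>\<close> is not a rational multiple of \<open>\<pi>\<close>, the directions \<open>k \<alpha> + l \<pi>/3\<close> with integers \<open>k\<close>, \<open>l\<close> determine
  \<open>k\<close> and the parity of \<open>l\<close>. So for either sign \<open>\<epsilon> = \<plusminus>1\<close> the rule \<open>\<epsilon>\<^sup>k (-1)\<^sup>l |z|\<close> defines such a \<open>\<psi>\<close>, put
  to zero in all other directions (\<open>exists_sign_character\<close>); directions are measured from \<open>AB\<close>. The three
  sides of a tile have directions differing by elements of this group, so each tile contributes
  \<open>0\<close> or \<open>\<plusminus>(c + \<epsilon> (a - b))\<close>, while \<open>ABC\<close> gives \<open>\<plusminus>(Y - 2 \<epsilon> X)\<close>. Hence there are integers \<open>n\<close>, \<open>m\<close> with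
  \<open>n (c + a - b) = Y - 2 X\<close> and \<open>m (c - a + b) = Y + 2 X\<close>. Comparing areas gives \<open>N b c = X Y\<close> for
  the number \<open>N\<close> of tiles.

  Since \<open>c\<^sup>2 = a\<^sup>2 + b\<^sup>2 + a b\<close> and \<open>Y c = X (2 b + a)\<close>, the two signed counts become
  \<open>n b c = X (c - a - b)\<close> and \<open>m b c = X (c + a + b)\<close>. Their quotient shows that \<open>c / (a + b)\<close> is rational, and
  their product together with the area equation shows that \<open>a / b\<close> is rational
  (\<open>tile_ratios_rational\<close>).
\<close>

section \<open>Vertical sections of a triangle\<close>

definition wedge :: "complex \<Rightarrow> complex \<Rightarrow> real" where
  "wedge z w = Re z * Im w - Im z * Re w"

definition slope :: "complex \<Rightarrow> complex \<Rightarrow> real" where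
  "slope p q = (Im q - Im p) / (Re q - Re p)"

definition chord :: "complex \<Rightarrow> complex \<Rightarrow> real \<Rightarrow> real" where
  "chord p q u = Im p + slope p q * (u - Re p)"

text \<open>The orientation sign makes the boundary traversed counterclockwise, whatever the order of
  the vertices, when \<open>\<phi>\<close> is antisymmetric.\<close>

definition edge_sum :: "(complex \<Rightarrow> complex \<Rightarrow> real) \<Rightarrow> complex \<Rightarrow> complex \<Rightarrow> complex \<Rightarrow> real" where
  "edge_sum \<phi> p q r = sgn (wedge (q - p) (r - p)) * (\<phi> p q + \<phi> q r + \<phi> r p)"

lemma collinear_iff_wedge: "collinear {p, q, r} \<longleftrightarrow> wedge (q - p) (r - p) = 0"
proof -
  have "collinear {p, q, r} \<longleftrightarrow> collinear {0, q - p, r - p}"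
    by (metis NO_MATCH_def collinear_3 insert_commute)
  also have "\<dots> \<longleftrightarrow> wedge (q - p) (r - p) = 0"
  proof
    assume "collinear {0, q - p, r - p}"
    then consider "q - p = 0" | "r - p = 0" | c where "r - p = c *\<^sub>R (q - p)"
      by (auto simp: collinear_lemma)
    then show "wedge (q - p) (r - p) = 0"
      by cases (auto simp: wedge_def)
  next
    assume w: "wedge (q - p) (r - p) = 0"
    show "collinear {0, q - p, r - p}"
    proof (cases "q = p")
      case False
      have "(r - p) * cnj (q - p) = of_real (Re ((r - p) * cnj (q - p)))"
        using w by (auto simp: complex_eq_iff wedge_def algebra_simps)
      moreover have "(q - p) * cnj (q - p) = of_real ((norm (q - p))\<^sup>2)"
        using complex_norm_square[of "q - p"] by simp
      ultimately have "(r - p) / (q - p) = of_real (Re ((r - p) * cnj (q - p)) / (norm (q - p))\<^sup>2)"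
        using False by (metis complex_div_cnj of_real_divide)
      then show ?thesis by (metis collinear_iff_Reals Reals_of_real)
    qed auto
  qed
  finally show ?thesis .
qed

lemma slope_commute: "slope p q = slope q p"
  unfolding slope_def by (metis minus_diff_eq minus_divide_divide)

lemma chord_commute: "Re p \<noteq> Re q \<Longrightarrow> chord p q u = chord q p u"
  by (simp add: chord_def slope_def divide_simps) (simp add: algebra_simps)

text \<open>If the line \<open>Re z = u\<close> separates \<open>p\<close> from \<open>q\<close> and \<open>r\<close>, it meets exactly the sides \<open>pq\<close> and \<open>pr\<close>.
  The orientation and the side on which \<open>p\<close> lies decide which of the two is the upper one.\<close>

lemma corner_section:
  assumes nc: "\<not> collinear {p, q, r}"
    and u: "Re p < u \<and> u < Re q \<and> u < Re r \<or> u < Re p \<and> Re q < u \<and> Re r < u"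
  shows "{y. Complex u y \<in> convex hull {p, q, r}} = closed_segment (chord p q u) (chord p r u)"
    and "{y. Complex u y \<in> interior (convex hull {p, q, r})} \<supseteq> open_segment (chord p q u) (chord p r u)"
    and "sgn (chord p r u - chord p q u) = sgn (wedge (q - p) (r - p)) * sgn (u - Re p)"
proof -
  define l where "l = (u - Re p) / (Re q - Re p)"
  define m where "m = (u - Re p) / (Re r - Re p)"
  have l: "0 < l" "l < 1" and m: "0 < m" "m < 1"
    using u by (auto simp: l_def m_def divide_simps)
  have ul: "u = Re p + l * (Re q - Re p)" and um: "u = Re p + m * (Re r - Re p)"
    using u by (auto simp: l_def m_def)
  have cl: "chord p q u = Im p + l * (Im q - Im p)" and cm: "chord p r u = Im p + m * (Im r - Im p)"
    by (simp_all add: chord_def slope_def l_def m_def)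
  \<comment> \<open>Barycentric coordinates along the section; they are positive strictly between the endpoints.\<close>
  have pt: "Complex u ((1 - s) * chord p q u + s * chord p r u)
      = ((1 - s) * (1 - l) + s * (1 - m)) *\<^sub>R p + ((1 - s) * l) *\<^sub>R q + (s * m) *\<^sub>R r" for s
  proof -
    have "u = (1 - s) * u + s * u" by (simp add: algebra_simps)
    also have "\<dots> = (1 - s) * (Re p + l * (Re q - Re p)) + s * (Re p + m * (Re r - Re p))"
      using ul um by simp
    finally show ?thesis unfolding cl cm by (auto simp: complex_eq_iff algebra_simps)
  qed
  show "{y. Complex u y \<in> convex hull {p, q, r}} = closed_segment (chord p q u) (chord p r u)"
  proof (intro set_eqI iffI)
    fix y assume "y \<in> {y. Complex u y \<in> convex hull {p, q, r}}"
    then obtain a b c where abc: "0 \<le> a" "0 \<le> b" "0 \<le> c" "a + b + c = 1"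
      and eq: "Complex u y = a *\<^sub>R p + b *\<^sub>R q + c *\<^sub>R r"
      by (auto simp: convex_hull_3)
    have re: "u = a * Re p + b * Re q + c * Re r" and im: "y = a * Im p + b * Im q + c * Im r"
      using eq by (auto simp: complex_eq_iff)
    have a: "a = 1 - b - c" using abc by simp
    have "u - Re p = b * (Re q - Re p) + c * (Re r - Re p)"
      using re by (simp add: a algebra_simps)
    also have "\<dots> = b * ((u - Re p) / l) + c * ((u - Re p) / m)"
      using u by (auto simp: l_def m_def)
    finally have "(u - Re p) * 1 = (u - Re p) * (b / l + c / m)"
      by (simp add: distrib_left mult.commute)
    then have s: "b / l + c / m = 1"
      using u by auto
    define t where "t = c / m"
    have "b / l \<ge> 0" "c / m \<ge> 0" using abc l m by simp_all
    then have t: "0 \<le> t" "t \<le> 1" using s by (simp_all add: t_def)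
    have "b / l = 1 - t" using s by (simp add: t_def)
    then have b: "b = (1 - t) * l" using l by (metis nonzero_divide_eq_eq order_less_irrefl)
    have c: "c = t * m" using m by (simp add: t_def)
    have "y = Im p + b * (Im q - Im p) + c * (Im r - Im p)" using im a by (simp add: algebra_simps)
    then have "y = (1 - t) * chord p q u + t * chord p r u"
      unfolding cl cm b c by (simp add: algebra_simps)
    with t show "y \<in> closed_segment (chord p q u) (chord p r u)"
      by (auto simp: in_segment)
  next
    fix y assume "y \<in> closed_segment (chord p q u) (chord p r u)"
    then obtain s where s: "0 \<le> s" "s \<le> 1" "y = (1 - s) * chord p q u + s * chord p r u"
      by (auto simp: in_segment)
    have "0 \<le> (1 - s) * (1 - l) + s * (1 - m)" "0 \<le> (1 - s) * l" "0 \<le> s * m"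
      using s l m by (auto intro!: add_nonneg_nonneg mult_nonneg_nonneg)
    moreover have "((1 - s) * (1 - l) + s * (1 - m)) + (1 - s) * l + s * m = 1"
      by (simp add: algebra_simps)
    ultimately show "y \<in> {y. Complex u y \<in> convex hull {p, q, r}}"
      using pt[of s] s unfolding convex_hull_3 mem_Collect_eq by metis
  qed
  show "{y. Complex u y \<in> interior (convex hull {p, q, r})} \<supseteq> open_segment (chord p q u) (chord p r u)"
  proof
    fix y assume "y \<in> open_segment (chord p q u) (chord p r u)"
    then obtain s where s: "0 < s" "s < 1" "y = (1 - s) * chord p q u + s * chord p r u"
      by (auto simp: in_segment)
    have "0 < (1 - s) * (1 - l) + s * (1 - m)" "0 < (1 - s) * l" "0 < s * m"
      using s l m by (auto intro!: add_pos_pos mult_pos_pos)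
    moreover have "((1 - s) * (1 - l) + s * (1 - m)) + (1 - s) * l + s * m = 1"
      by (simp add: algebra_simps)
    ultimately show "y \<in> {y. Complex u y \<in> interior (convex hull {p, q, r})}"
      using pt[of s, symmetric] s unfolding interior_convex_hull_3_minimal[OF nc DIM_complex] by blast
  qed
  have "chord p r u - chord p q u
      = wedge (q - p) (r - p) * (u - Re p) / ((Re q - Re p) * (Re r - Re p))"
    using u by (auto simp: cl cm l_def m_def wedge_def divide_simps) (simp_all add: algebra_simps)
  moreover have "(Re q - Re p) * (Re r - Re p) > 0"
    using u by (auto intro: mult_pos_pos mult_neg_neg)
  ultimately show "sgn (chord p r u - chord p q u) = sgn (wedge (q - p) (r - p)) * sgn (u - Re p)"
    by (simp only: sgn_divide sgn_pos) (simp add: sgn_mult)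
qed

text \<open>An endpoint shared by two neighbouring intervals cancels, whatever the values of \<open>W\<close>.\<close>

lemma sum_over_interval_partition:
  fixes W :: "real \<Rightarrow> real" and l h :: "'i \<Rightarrow> real"
  assumes fin: "finite I" and lh: "\<And>i. i \<in> I \<Longrightarrow> l i < h i"
    and disj: "\<And>i j. i \<in> I \<Longrightarrow> j \<in> I \<Longrightarrow> i \<noteq> j \<Longrightarrow> {l i<..<h i} \<inter> {l j<..<h j} = {}"
    and un: "(\<Union>i\<in>I. {l i..h i}) = {a..b}" and ab: "a \<le> b"
  shows "(\<Sum>i\<in>I. W (l i) - W (h i)) = W a - W b"
proof -
  let ?g = "\<lambda>i. (l i, {l i..h i})"
  have inj: "inj_on ?g I"
  proof (rule inj_onI, rule ccontr)
    fix i j assume "i \<in> I" "j \<in> I" "?g i = ?g j" "i \<noteq> j"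
    then have "l i = l j \<and> h i = h j"
      using lh[OF \<open>i \<in> I\<close>] lh[OF \<open>j \<in> I\<close>] by (auto simp: Icc_eq_Icc)
    then have "{l i<..<h i} = {}" using disj[OF \<open>i \<in> I\<close> \<open>j \<in> I\<close> \<open>i \<noteq> j\<close>] by simp
    then show False using lh[OF \<open>i \<in> I\<close>] by simp
  qed
  have td: "(?g ` I) tagged_division_of {a..b}"
  proof (rule tagged_division_ofI)
    show "finite (?g ` I)" using fin by simp
    show "\<And>x K. (x, K) \<in> ?g ` I \<Longrightarrow> x \<in> K" using lh by (auto simp: less_imp_le)
    show "\<And>x K. (x, K) \<in> ?g ` I \<Longrightarrow> K \<subseteq> {a..b}" using un by blast
    show "\<And>x K. (x, K) \<in> ?g ` I \<Longrightarrow> \<exists>a b. K = cbox a b" by auto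
    show "\<Union>{K. \<exists>x. (x, K) \<in> ?g ` I} = {a..b}"
      unfolding un[symmetric] by (auto simp: image_iff)
    fix x1 K1 x2 K2
    assume "(x1, K1) \<in> ?g ` I" "(x2, K2) \<in> ?g ` I" "(x1, K1) \<noteq> (x2, K2)"
    then obtain i j where "i \<in> I" "j \<in> I" "i \<noteq> j" "K1 = {l i..h i}" "K2 = {l j..h j}" by auto
    then show "interior K1 \<inter> interior K2 = {}" using disj by (simp add: interior_atLeastAtMost_real)
  qed
  have "W b - W a = (\<Sum>(x,K)\<in>?g ` I. W (Sup K) - W (Inf K))"
    using additive_tagged_division_1[OF ab td, of W] by simp
  also have "\<dots> = (\<Sum>i\<in>I. W (h i) - W (l i))"
    by (subst sum.reindex[OF inj]) (auto intro!: sum.cong simp: less_imp_le lh)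
  finally show ?thesis by (simp add: sum_subtractf)
qed

section \<open>Additivity of edge sums under tiling\<close>

text \<open>The integrand that an edge contributes on the vertical line \<open>Re z = u\<close>, with a sign for
  the horizontal direction in which the edge is traversed. The weight \<open>f\<close> may depend on the slope of the
  edge and on the height at which the line is met.\<close>

definition strip :: "(real \<Rightarrow> real \<Rightarrow> real) \<Rightarrow> complex \<Rightarrow> complex \<Rightarrow> real \<Rightarrow> real" where
  "strip f p q u = f (slope p q) (chord p q u) *
     ((if Re p < u \<and> u < Re q then 1 else 0) - (if Re q < u \<and> u < Re p then 1 else 0))"

text \<open>Pairs of slope and intercept. A vertical side yields a horizontal line, since division by
  zero gives slope \<open>0\<close>; such a line only adds finitely many crossing points to be avoided.\<close>

definition edge_lines :: "complex \<Rightarrow> complex \<Rightarrow> complex \<Rightarrow> (real \<times> real) set" where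
  "edge_lines p q r = (\<lambda>(z, w). (slope z w, Im z - slope z w * Re z)) ` {(p, q), (q, r), (r, p)}"

lemma edge_sum_rotate: "edge_sum \<phi> q r p = edge_sum \<phi> p q r"
proof -
  have "wedge (r - q) (p - q) = wedge (q - p) (r - p)" by (simp add: wedge_def algebra_simps)
  then show ?thesis by (simp add: edge_sum_def algebra_simps)
qed

lemma edge_lines_rotate: "edge_lines q r p = edge_lines p q r"
  by (auto simp: edge_lines_def)

lemma strip_commute: "strip f q p u = - strip f p q u"
  by (cases "Re p = Re q") (auto simp: strip_def slope_commute[of q p] chord_commute[of q p])

lemma has_integral_strip:
  assumes int: "\<And>z w. Re z < Re w \<Longrightarrow>
      ((\<lambda>u. f (slope z w) (chord z w u)) has_integral \<phi> z w) {Re z..Re w}"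
    and anti: "\<And>z w. \<phi> w z = - \<phi> z w" and vert: "\<And>z w. Re z = Re w \<Longrightarrow> \<phi> z w = 0"
  shows "(strip f z w has_integral \<phi> z w) UNIV"
proof -
  have pos: "(strip f z w has_integral \<phi> z w) UNIV" if "Re z < Re w" for z w
  proof -
    have "((\<lambda>u. if u \<in> {Re z..Re w} then f (slope z w) (chord z w u) else 0)
        has_integral \<phi> z w) UNIV"
      using int[OF that] by (subst has_integral_restrict_UNIV)
    then show ?thesis
      by (rule has_integral_spike_finite[where S = "{Re z, Re w}", rotated 2])
        (use that in \<open>auto simp: strip_def\<close>)
  qed
  consider "Re z < Re w" | "Re w < Re z" | "Re z = Re w" by linarith
  then show ?thesis
  proof cases
    case 2
    then have "((\<lambda>u. - strip f w z u) has_integral - \<phi> w z) UNIV"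
      by (intro has_integral_neg pos)
    then show ?thesis by (simp flip: strip_commute anti)
  next
    case 3
    then have "strip f z w = (\<lambda>u. 0)" by (auto simp: strip_def)
    then show ?thesis using 3 by (simp add: vert)
  qed (rule pos)
qed

text \<open>A counterclockwise traversal runs to the right along the bottom of a triangle and to the left
  along its top, so on each vertical line that meets the interior the lower edge counts positively and
  the upper edge negatively.\<close>

definition is_section ::
    "(real \<Rightarrow> real \<Rightarrow> real) \<Rightarrow> complex \<Rightarrow> complex \<Rightarrow> complex \<Rightarrow> real \<Rightarrow> real \<Rightarrow> real \<Rightarrow> bool" where
  "is_section f p q r u l h \<longleftrightarrow> l < h \<and> {y. Complex u y \<in> convex hull {p, q, r}} = {l..h} \<and>
     {l<..<h} \<subseteq> {y. Complex u y \<in> interior (convex hull {p, q, r})} \<and>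
     (\<exists>(m, k) \<in> edge_lines p q r. \<exists>(m', k') \<in> edge_lines p q r.
        l = m * u + k \<and> h = m' * u + k' \<and>
        edge_sum (\<lambda>z w. strip f z w u) p q r = f m l - f m' h)"

lemma section_at_corner:
  assumes nc: "\<not> collinear {p, q, r}"
    and u: "Re p < u \<and> u < Re q \<and> u < Re r \<or> u < Re p \<and> Re q < u \<and> Re r < u"
  shows "\<exists>l h. is_section f p q r u l h"
proof -
  note cs = corner_section[OF nc u]
  define y where "y = chord p q u"
  define y' where "y' = chord p r u"
  have y2: "y' = chord r p u" using u by (auto simp: y'_def intro: chord_commute)
  have L: "(slope p q, Im p - slope p q * Re p) \<in> edge_lines p q r"
      "(slope r p, Im r - slope r p * Re r) \<in> edge_lines p q r"
    by (auto simp: edge_lines_def)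
  have yL: "y = slope p q * u + (Im p - slope p q * Re p)"
      "y' = slope r p * u + (Im r - slope r p * Re r)"
    unfolding y2 y_def chord_def by (simp_all add: algebra_simps)
  have w: "wedge (q - p) (r - p) \<noteq> 0" using nc by (simp add: collinear_iff_wedge)
  have sg: "sgn (y' - y) = sgn (wedge (q - p) (r - p)) * sgn (u - Re p)"
    using cs(3) by (simp add: y_def y'_def)
  have K: "edge_sum (\<lambda>z w. strip f z w u) p q r
      = sgn (wedge (q - p) (r - p)) * sgn (u - Re p) * (f (slope p q) y - f (slope r p) y')"
    using u unfolding edge_sum_def strip_def y2 y_def by (auto simp: algebra_simps)
  then have K: "edge_sum (\<lambda>z w. strip f z w u) p q r
      = sgn (y' - y) * (f (slope p q) y - f (slope r p) y')" by (simp add: sg)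
  have "y \<noteq> y'" using sg w u by (auto simp: sgn_if split: if_splits)
  then consider "y < y'" | "y' < y" by linarith
  then show ?thesis
  proof cases
    case 1
    then have "is_section f p q r u y y'"
      unfolding is_section_def
      using cs(1,2)[folded y_def y'_def] yL K
      by (simp add: closed_segment_eq_real_ivl open_segment_eq_real_ivl)
         (rule bexI[OF _ L(1)], simp, rule bexI[OF _ L(2)], simp)
    then show ?thesis by blast
  next
    case 2
    then have "is_section f p q r u y' y"
      unfolding is_section_def
      using cs(1,2)[folded y_def y'_def] yL K
      by (simp add: closed_segment_eq_real_ivl open_segment_eq_real_ivl)
         (rule bexI[OF _ L(2)], simp, rule bexI[OF _ L(1)], simp)
    then show ?thesis by blast
  qed
qed

lemma is_section_rotate: "is_section f q r p u l h \<longleftrightarrow> is_section f p q r u l h"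
proof -
  have "{q, r, p} = {p, q, r}" by auto
  then show ?thesis
    by (simp add: is_section_def edge_sum_rotate[of _ q r p] edge_lines_rotate[of q r p])
qed

lemma triangle_section:
  assumes nc: "\<not> collinear {p, q, r}" and u: "u \<notin> {Re p, Re q, Re r}"
  shows "{y. Complex u y \<in> convex hull {p, q, r}} = {} \<and>
      edge_sum (\<lambda>z w. strip f z w u) p q r = 0 \<or> (\<exists>l h. is_section f p q r u l h)"
proof -
  consider (out) "Re p < u \<and> Re q < u \<and> Re r < u \<or> u < Re p \<and> u < Re q \<and> u < Re r"
    | (p) "Re p < u \<and> u < Re q \<and> u < Re r \<or> u < Re p \<and> Re q < u \<and> Re r < u"
    | (q) "Re q < u \<and> u < Re r \<and> u < Re p \<or> u < Re q \<and> Re r < u \<and> Re p < u"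
    | (r) "Re r < u \<and> u < Re p \<and> u < Re q \<or> u < Re r \<and> Re p < u \<and> Re q < u"
    using u by (metis insertCI linorder_neqE_linordered_idom)
  then show ?thesis
  proof cases
    case out
    then have "convex hull {p, q, r} \<subseteq> {z. Re z < u} \<or> convex hull {p, q, r} \<subseteq> {z. Re z > u}"
    proof
      assume "Re p < u \<and> Re q < u \<and> Re r < u"
      then have "convex hull {p, q, r} \<subseteq> {z. Re z < u}"
        by (intro hull_minimal convex_halfspace_Re_lt) auto
      then show ?thesis ..
    next
      assume "u < Re p \<and> u < Re q \<and> u < Re r"
      then have "convex hull {p, q, r} \<subseteq> {z. Re z > u}"
        by (intro hull_minimal convex_halfspace_Re_gt) auto
      then show ?thesis ..
    qed
    then have "{y. Complex u y \<in> convex hull {p, q, r}} = {}" by auto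
    moreover have "edge_sum (\<lambda>z w. strip f z w u) p q r = 0"
      using out by (auto simp: edge_sum_def strip_def)
    ultimately show ?thesis by blast
  next
    case p
    then show ?thesis using section_at_corner[OF nc p] by blast
  next
    case q
    have "\<not> collinear {q, r, p}" using nc by (simp add: insert_commute)
    then show ?thesis using section_at_corner[OF _ q] is_section_rotate by blast
  next
    case r
    have "\<not> collinear {r, p, q}" using nc by (simp add: insert_commute)
    then show ?thesis using section_at_corner[OF _ r] is_section_rotate by blast
  qed
qed

text \<open>On a vertical line that passes through no vertex and through no crossing of two different edge lines,
  all edges through a given point have the same slope, so the weight \<open>f\<close> becomes a function \<open>W\<close> of
  the height alone. The sections of the tiles partition the section of the large triangle, hence
  the differences of \<open>W\<close> at their endpoints telescope. All but finitely many vertical lines are of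
  this kind, and integrating over them gives the claim.\<close>

theorem sweep_additivity:
  fixes p q r :: "'i \<Rightarrow> complex" and A B C :: complex
  assumes fin: "finite I"
    and nc: "\<And>i. i \<in> I \<Longrightarrow> \<not> collinear {p i, q i, r i}" and ncS: "\<not> collinear {A, B, C}"
    and disj: "\<And>i j. i \<in> I \<Longrightarrow> j \<in> I \<Longrightarrow> i \<noteq> j \<Longrightarrow>
        interior (convex hull {p i, q i, r i}) \<inter> interior (convex hull {p j, q j, r j}) = {}"
    and un: "(\<Union>i\<in>I. convex hull {p i, q i, r i}) = convex hull {A, B, C}"
    and int: "\<And>z w. Re z < Re w \<Longrightarrow>
        ((\<lambda>u. f (slope z w) (chord z w u)) has_integral \<phi> z w) {Re z..Re w}"
    and anti: "\<And>z w. \<phi> w z = - \<phi> z w" and vert: "\<And>z w. Re z = Re w \<Longrightarrow> \<phi> z w = 0"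
  shows "(\<Sum>i\<in>I. edge_sum \<phi> (p i) (q i) (r i)) = edge_sum \<phi> A B C"
proof -
  define K where "K = (\<lambda>p q r u. edge_sum (\<lambda>z w. strip f z w u) p q r)"
  have K_int: "(K p q r has_integral edge_sum \<phi> p q r) UNIV" for p q r
    unfolding K_def edge_sum_def
    by (intro has_integral_mult_right has_integral_add has_integral_strip[OF int anti vert])
  define L where "L = edge_lines A B C \<union> (\<Union>i\<in>I. edge_lines (p i) (q i) (r i))"
  \<comment> \<open>For parallel lines the quotient is \<open>0\<close>, which excludes one more vertical line.\<close>
  define crossings where
    "crossings = (\<lambda>((m, k), (m', k')). (k' - k) / (m - m')) ` (L \<times> L)"
  define bad where
    "bad = crossings \<union> Re ` ({A, B, C} \<union> p ` I \<union> q ` I \<union> r ` I)"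
  have "finite L" using fin by (auto simp: L_def edge_lines_def)
  then have bad: "finite bad" using fin by (simp add: bad_def crossings_def)
  have eq: "(\<Sum>i\<in>I. K (p i) (q i) (r i) u) = K A B C u" if u: "u \<notin> bad" for u
  proof -
    define m_at where "m_at = (\<lambda>y. SOME m. \<exists>k. (m, k) \<in> L \<and> y = m * u + k)"
    have m_at: "m_at y = m" if "(m, k) \<in> L" "y = m * u + k" for y m k
      unfolding m_at_def
    proof (rule some_equality)
      fix m' assume "\<exists>k'. (m', k') \<in> L \<and> y = m' * u + k'"
      then obtain k' where k': "(m', k') \<in> L" "y = m' * u + k'" by blast
      show "m' = m"
      proof (rule ccontr)
        assume "m' \<noteq> m"
        then have "u = (k' - k) / (m - m')" using k' that by (simp add: field_simps)
        moreover have "((m, k), (m', k')) \<in> L \<times> L" using k' that by simp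
        ultimately have "u \<in> crossings" unfolding crossings_def by force
        then show False using u by (simp add: bad_def)
      qed
    qed (use that in blast)
    define W where "W = (\<lambda>y. f (m_at y) y)"
    have W: "K p q r u = W l - W h" if "is_section f p q r u l h" "edge_lines p q r \<subseteq> L" for p q r l h
    proof -
      from that(1) obtain x y where xy: "x \<in> edge_lines p q r" "y \<in> edge_lines p q r"
        and l: "l = fst x * u + snd x" and h: "h = fst y * u + snd y"
        and K: "K p q r u = f (fst x) l - f (fst y) h"
        unfolding is_section_def K_def case_prod_beta by blast
      have "(fst x, snd x) \<in> L" "(fst y, snd y) \<in> L" using xy that(2) by auto
      from m_at[OF this(1) l] m_at[OF this(2) h] show ?thesis using K by (simp add: W_def)
    qed
    define J where "J = {i \<in> I. {y. Complex u y \<in> convex hull {p i, q i, r i}} \<noteq> {}}"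
    have tile: "{y. Complex u y \<in> convex hull {p i, q i, r i}} = {} \<and> K (p i) (q i) (r i) u = 0 \<or>
        (\<exists>l h. is_section f (p i) (q i) (r i) u l h)" if "i \<in> I" for i
      unfolding K_def using u that by (intro triangle_section nc) (auto simp: bad_def)
    have "\<exists>l h. is_section f (p i) (q i) (r i) u l h" if "i \<in> J" for i
      using tile[of i] that by (auto simp: J_def)
    then obtain l h where lh: "\<And>i. i \<in> J \<Longrightarrow> is_section f (p i) (q i) (r i) u (l i) (h i)"
      by metis
    have J: "finite J" "J \<subseteq> I" using fin by (auto simp: J_def)
    have "(\<Sum>i\<in>I. K (p i) (q i) (r i) u) = (\<Sum>i\<in>J. K (p i) (q i) (r i) u)"
    proof (intro sum.mono_neutral_right ballI)
      fix i assume "i \<in> I - J"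
      then have "i \<in> I" "{y. Complex u y \<in> convex hull {p i, q i, r i}} = {}"
        by (auto simp: J_def)
      then show "K (p i) (q i) (r i) u = 0" using tile[of i] by (auto simp: is_section_def)
    qed (use fin J in auto)
    also have "\<dots> = (\<Sum>i\<in>J. W (l i) - W (h i))"
      using J by (intro sum.cong refl W lh) (auto simp: L_def)
    also have "\<dots> = K A B C u"
    proof -
      have secun: "(\<Union>i\<in>J. {l i..h i}) = {y. Complex u y \<in> convex hull {A, B, C}}"
      proof -
        have "(\<Union>i\<in>J. {l i..h i}) = (\<Union>i\<in>J. {y. Complex u y \<in> convex hull {p i, q i, r i}})"
          using lh by (intro SUP_cong) (auto simp: is_section_def)
        also have "\<dots> = {y. Complex u y \<in> (\<Union>i\<in>I. convex hull {p i, q i, r i})}"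
          by (auto simp: J_def)
        finally show ?thesis by (simp add: un)
      qed
      have "{y. Complex u y \<in> convex hull {A, B, C}} = {} \<and> K A B C u = 0 \<or>
          (\<exists>a b. is_section f A B C u a b)"
        unfolding K_def using u by (intro triangle_section ncS) (auto simp: bad_def)
      then show ?thesis
      proof
        assume *: "{y. Complex u y \<in> convex hull {A, B, C}} = {} \<and> K A B C u = 0"
        have "l i \<in> (\<Union>i\<in>J. {l i..h i})" if "i \<in> J" for i
          using lh[OF that] that by (force simp: is_section_def)
        then have "J = {}" using * secun by auto
        then show ?thesis using * by simp
      next
        assume "\<exists>a b. is_section f A B C u a b"
        then obtain a b where ab: "is_section f A B C u a b" by blast
        have "(\<Sum>i\<in>J. W (l i) - W (h i)) = W a - W b"
        proof (rule sum_over_interval_partition[where W = W and l = l and h = h])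
          show "(\<Union>i\<in>J. {l i..h i}) = {a..b}" "a \<le> b"
            using secun ab by (auto simp: is_section_def)
          show "l i < h i" if "i \<in> J" for i using lh[OF that] by (simp add: is_section_def)
          show "{l i<..<h i} \<inter> {l j<..<h j} = {}" if "i \<in> J" "j \<in> J" "i \<noteq> j" for i j
            using lh[OF that(1)] lh[OF that(2)] disj[of i j] that J
            unfolding is_section_def by blast
        qed (rule J)
        also have "\<dots> = K A B C u" using W[OF ab] by (simp add: L_def)
        finally show ?thesis .
      qed
    qed
    finally show ?thesis .
  qed
  have "((\<lambda>u. \<Sum>i\<in>I. K (p i) (q i) (r i) u) has_integral
      (\<Sum>i\<in>I. edge_sum \<phi> (p i) (q i) (r i))) UNIV"
    using fin K_int by (intro has_integral_sum) auto
  then have "(K A B C has_integral (\<Sum>i\<in>I. edge_sum \<phi> (p i) (q i) (r i))) UNIV"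
    by (rule has_integral_spike_finite[OF bad, rotated]) (simp add: eq)
  then show ?thesis using K_int has_integral_unique by blast
qed

text \<open>With the height itself as weight, the edge sum is minus the area.\<close>

lemma sum_area_additive:
  fixes p q r :: "'i \<Rightarrow> complex" and A B C :: complex
  assumes fin: "finite I"
    and nc: "\<And>i. i \<in> I \<Longrightarrow> \<not> collinear {p i, q i, r i}" and ncS: "\<not> collinear {A, B, C}"
    and disj: "\<And>i j. i \<in> I \<Longrightarrow> j \<in> I \<Longrightarrow> i \<noteq> j \<Longrightarrow>
        interior (convex hull {p i, q i, r i}) \<inter> interior (convex hull {p j, q j, r j}) = {}"
    and un: "(\<Union>i\<in>I. convex hull {p i, q i, r i}) = convex hull {A, B, C}"
  shows "(\<Sum>i\<in>I. \<bar>wedge (q i - p i) (r i - p i)\<bar>) = \<bar>wedge (B - A) (C - A)\<bar>"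
proof -
  let ?\<phi> = "\<lambda>z w. (Im z + Im w) / 2 * (Re w - Re z)"
  have E: "edge_sum ?\<phi> p q r = - (\<bar>wedge (q - p) (r - p)\<bar> / 2)" for p q r
  proof -
    have "?\<phi> p q + ?\<phi> q r + ?\<phi> r p = - (wedge (q - p) (r - p) / 2)"
      by (simp add: wedge_def field_simps)
    then show ?thesis by (simp only: edge_sum_def) (simp add: abs_sgn mult.commute)
  qed
  have "(\<Sum>i\<in>I. edge_sum ?\<phi> (p i) (q i) (r i)) = edge_sum ?\<phi> A B C"
  proof (rule sweep_additivity[where f = "\<lambda>m y. y", OF fin nc ncS disj un])
    fix z w :: complex assume lt: "Re z < Re w"
    let ?F = "\<lambda>u. Im z * u + slope z w * (u - Re z)\<^sup>2 / 2"
    have F: "(chord z w has_integral ?F (Re w) - ?F (Re z)) {Re z..Re w}"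
      using lt unfolding chord_def
      by (intro fundamental_theorem_of_calculus)
        (auto intro!: derivative_eq_intros simp flip: has_real_derivative_iff_has_vector_derivative)
    have "slope z w * (Re w - Re z)\<^sup>2 = (Im w - Im z) * (Re w - Re z)"
      using lt by (simp add: slope_def power2_eq_square)
    then have eq: "?F (Re w) - ?F (Re z) = ?\<phi> z w" by (simp add: field_simps)
    show "((\<lambda>u. chord z w u) has_integral ?\<phi> z w) {Re z..Re w}" using F unfolding eq .
  qed (auto simp: field_simps)
  then show ?thesis unfolding E by (simp add: sum_negf flip: sum_divide_distrib)
qed

text \<open>Vertical edges are invisible to the sweep, so the figure has to be turned first.\<close>

lemma exists_nonvertical_direction:
  fixes D :: "complex set"
  assumes "finite D" "0 \<notin> D"
  obtains v where "v \<noteq> 0" "\<And>e. e \<in> D \<Longrightarrow> Re (v * e) \<noteq> 0"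
proof -
  \<comment> \<open>For \<open>v = 1 + s \<i>\<close> each \<open>e\<close> excludes at most one value of \<open>s\<close>.\<close>
  have "finite ((\<lambda>e. Re e / Im e) ` D)" using assms by simp
  then obtain s where s: "s \<notin> (\<lambda>e. Re e / Im e) ` D"
    using ex_new_if_finite infinite_UNIV_char_0 by blast
  show ?thesis
  proof (rule that)
    show "Complex 1 s \<noteq> 0" by (simp add: complex_eq_iff)
    fix e assume e: "e \<in> D"
    have "Re e \<noteq> s * Im e"
    proof
      assume *: "Re e = s * Im e"
      show False
      proof (cases "Im e = 0")
        case True
        then show False using * e assms(2) by (metis complex_eqI mult_zero_right zero_complex.simps)
      next
        case False
        then have "s = Re e / Im e" using * by simp
        then show False using s e by blast
      qed
    qed
    then show "Re (Complex 1 s * e) \<noteq> 0" by simp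
  qed
qed

text \<open>For an edge that is not vertical, \<open>\<psi>\<close> is the horizontal extent times a function of the slope,
  so it is the integral of a weight that ignores the height.\<close>

theorem homogeneous_edge_sum_additive:
  fixes p q r :: "'i \<Rightarrow> complex" and A B C :: complex and \<psi> :: "complex \<Rightarrow> real"
  assumes fin: "finite I"
    and nc: "\<And>i. i \<in> I \<Longrightarrow> \<not> collinear {p i, q i, r i}" and ncS: "\<not> collinear {A, B, C}"
    and disj: "\<And>i j. i \<in> I \<Longrightarrow> j \<in> I \<Longrightarrow> i \<noteq> j \<Longrightarrow>
        interior (convex hull {p i, q i, r i}) \<inter> interior (convex hull {p j, q j, r j}) = {}"
    and un: "(\<Union>i\<in>I. convex hull {p i, q i, r i}) = convex hull {A, B, C}"
    and hom: "\<And>x z. \<psi> (of_real x * z) = x * \<psi> z"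
  shows "(\<Sum>i\<in>I. edge_sum (\<lambda>z w. \<psi> (w - z)) (p i) (q i) (r i)) = edge_sum (\<lambda>z w. \<psi> (w - z)) A B C"
proof -
  define D where "D = (\<lambda>(p::complex, q, r). {q - p, r - q, p - r})"
  define Ds where "Ds = D (A, B, C) \<union> (\<Union>i\<in>I. D (p i, q i, r i))"
  have D0: "0 \<notin> D (p, q, r)" if "\<not> collinear {p, q, r}" for p q r
    using that by (auto simp: D_def insert_commute)
  have "0 \<notin> Ds" using D0 nc ncS by (auto simp: Ds_def)
  moreover have "finite Ds" using fin by (auto simp: Ds_def D_def)
  ultimately obtain v where v: "v \<noteq> 0" "\<And>e. e \<in> Ds \<Longrightarrow> Re (v * e) \<noteq> 0"
    using exists_nonvertical_direction by metis
  define \<rho> where "\<rho> = (\<lambda>m. \<psi> (Complex 1 m / v))"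
  define \<phi> where "\<phi> = (\<lambda>z w. (Re w - Re z) * \<rho> (slope z w))"
  have \<phi>: "\<phi> (v * z) (v * w) = \<psi> (w - z)" if "Re (v * (w - z)) \<noteq> 0" for z w
  proof -
    define z' where "z' = v * z"
    define w' where "w' = v * w"
    have ne: "Re w' - Re z' \<noteq> 0" using that by (simp add: z'_def w'_def algebra_simps)
    have "of_real (Re w' - Re z') * Complex 1 (slope z' w') = w' - z'"
      using ne by (simp add: slope_def complex_eq_iff)
    then have "of_real (Re w' - Re z') * (Complex 1 (slope z' w') / v) = (w' - z') / v"
      by (metis times_divide_eq_right)
    also have "\<dots> = w - z" using v(1) by (simp add: z'_def w'_def diff_divide_distrib)
    finally show ?thesis unfolding \<phi>_def \<rho>_def by (metis hom z'_def w'_def)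
  qed
  have wv: "wedge (v * z) (v * w) = (norm v)\<^sup>2 * wedge z w" for z w
    unfolding wedge_def cmod_power2 by (simp add: algebra_simps power2_eq_square)
  have sg: "sgn (wedge (v * q - v * p) (v * r - v * p)) = sgn (wedge (q - p) (r - p))" for p q r
    using v(1) wv[of "q - p" "r - p"] by (simp add: right_diff_distrib sgn_mult)
  have E: "edge_sum \<phi> (v * p) (v * q) (v * r) = edge_sum (\<lambda>z w. \<psi> (w - z)) p q r"
    if "D (p, q, r) \<subseteq> Ds" for p q r
  proof -
    have "q - p \<in> Ds" "r - q \<in> Ds" "p - r \<in> Ds" using that by (auto simp: D_def)
    from this[THEN v(2), THEN \<phi>] show ?thesis by (simp only: edge_sum_def sg)
  qed
  have lin: "linear ((*) v)" by (rule linear_times)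
  have inj: "inj ((*) v)" using v(1) by (auto simp: inj_on_def)
  have hull: "convex hull {v * p, v * q, v * r} = (*) v ` (convex hull {p, q, r})" for p q r
    using convex_hull_linear_image[OF lin, of "{p, q, r}"] by simp
  have int: "interior (convex hull {v * p, v * q, v * r})
      = (*) v ` interior (convex hull {p, q, r})" for p q r
    unfolding hull by (rule interior_injective_linear_image[OF lin inj])
  have col: "collinear {v * p, v * q, v * r} \<longleftrightarrow> collinear {p, q, r}" for p q r
    unfolding collinear_iff_wedge using sg[of q p r] by (metis sgn_zero_iff)
  \<comment> \<open>Sweeping the figure multiplied by \<open>v\<close>, in which no edge is vertical.\<close>
  have "(\<Sum>i\<in>I. edge_sum \<phi> (v * p i) (v * q i) (v * r i)) = edge_sum \<phi> (v * A) (v * B) (v * C)"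
  proof (rule sweep_additivity[where f = "\<lambda>m y. \<rho> m"])
    show "interior (convex hull {v * p i, v * q i, v * r i}) \<inter>
        interior (convex hull {v * p j, v * q j, v * r j}) = {}" if "i \<in> I" "j \<in> I" "i \<noteq> j" for i j
      unfolding int using disj[OF that] inj by (metis image_Int image_empty)
    show "(\<Union>i\<in>I. convex hull {v * p i, v * q i, v * r i}) = convex hull {v * A, v * B, v * C}"
      unfolding hull by (simp flip: un add: image_UN)
    show "((\<lambda>u. \<rho> (slope z w)) has_integral \<phi> z w) {Re z..Re w}" if "Re z < Re w" for z w
      using has_integral_const_real[of "\<rho> (slope z w)" "Re z" "Re w"] that by (simp add: \<phi>_def)
    show "\<phi> w z = - \<phi> z w" for z w
      by (simp add: \<phi>_def slope_commute[of w z] algebra_simps)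
  qed (use nc ncS col fin in \<open>auto simp: \<phi>_def\<close>)
  moreover have "(\<Sum>i\<in>I. edge_sum \<phi> (v * p i) (v * q i) (v * r i)) =
      (\<Sum>i\<in>I. edge_sum (\<lambda>z w. \<psi> (w - z)) (p i) (q i) (r i))"
    by (intro sum.cong refl E) (auto simp: Ds_def)
  moreover have "edge_sum \<phi> (v * A) (v * B) (v * C) = edge_sum (\<lambda>z w. \<psi> (w - z)) A B C"
    by (rule E) (auto simp: Ds_def)
  ultimately show ?thesis by simp
qed

section \<open>Signed lengths depending on the direction\<close>

text \<open>A signed length whose sign is multiplied by \<open>\<epsilon>\<close> under rotation by \<open>\<alpha>\<close> and by \<open>-1\<close> under
  rotation by \<open>\<pi>/3\<close>. The value \<open>-1\<close> agrees with oddness, since three rotations by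
  \<open>\<pi>/3\<close> make a half turn.\<close>

locale sign_character =
  fixes \<psi> :: "complex \<Rightarrow> real" and \<alpha> \<epsilon> :: real
  assumes hom: "\<psi> (of_real x * z) = x * \<psi> z" and one: "\<psi> 1 = 1"
    and alpha: "\<psi> (z * cis \<alpha>) = \<epsilon> * \<psi> z" and third: "\<psi> (z * cis (pi / 3)) = - \<psi> z"
    and val: "\<psi> z \<in> {norm z, 0, - norm z}" and eps: "\<epsilon> = 1 \<or> \<epsilon> = - 1"
begin

lemma rotate_alpha: "\<sigma> = 1 \<or> \<sigma> = - 1 \<Longrightarrow> \<psi> (z * cis (\<sigma> * \<alpha>)) = \<epsilon> * \<psi> z"
  using alpha[of z] alpha[of "z * cis (- \<alpha>)"] eps by (auto simp: mult.assoc cis_mult)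

lemma rotate_third: "\<sigma> = 1 \<or> \<sigma> = - 1 \<Longrightarrow> \<psi> (z * cis (\<sigma> * (pi / 3))) = - \<psi> z"
  using third[of z] third[of "z * cis (- (pi / 3))"] by (auto simp: mult.assoc cis_mult)

lemma minus: "\<psi> (- z) = - \<psi> z"
  using hom[of "- 1" z] by simp

end

text \<open>Irrationality of \<open>\<alpha> / \<pi>\<close> makes \<open>k\<close> and the parity of \<open>l\<close> readable from the direction
  \<open>k \<alpha> + l \<pi>/3\<close>, which is defined modulo \<open>2\<pi> = 6 (\<pi>/3)\<close> only.\<close>

lemma exists_sign_character:
  fixes \<alpha> \<epsilon> :: real
  assumes irr: "\<not> (\<exists>q\<in>\<rat>. \<alpha> = q * pi)" and \<epsilon>: "\<epsilon> = 1 \<or> \<epsilon> = - 1"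
  obtains \<psi> where "sign_character \<psi> \<alpha> \<epsilon>"
proof -
  define dir :: "int \<Rightarrow> int \<Rightarrow> complex" where "dir = (\<lambda>k l. cis (k * \<alpha> + l * (pi / 3)))"
  define val :: "int \<Rightarrow> int \<Rightarrow> real" where
    "val = (\<lambda>k l. (if even k then 1 else \<epsilon>) * (if even l then 1 else - 1))"
  have dir_eq: "k = k' \<and> (even l \<longleftrightarrow> even l')" if "dir k l = dir k' l'" for k l k' l'
  proof -
    have "cis ((k - k') * \<alpha> + (l - l') * (pi / 3)) = dir k l / dir k' l'"
      by (simp add: dir_def cis_divide algebra_simps diff_divide_distrib)
    also have "\<dots> = 1" using that by (simp add: dir_def)
    finally have "cos ((k - k') * \<alpha> + (l - l') * (pi / 3)) = 1" by (simp add: complex_eq_iff)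
    then obtain n :: int where n: "(k - k') * \<alpha> + (l - l') * (pi / 3) = n * (2 * pi)"
      unfolding cos_one_2pi_int by (auto simp: algebra_simps)
    have kk: "k = k'"
    proof (rule ccontr)
      assume "k \<noteq> k'"
      then have "\<alpha> = (2 * n - (l - l') / 3) / (k - k') * pi"
        using n by (simp add: field_simps)
      moreover have "(2 * n - (l - l') / 3) / (k - k') \<in> \<rat>" for n l l' k k' :: int
        by (intro Rats_divide Rats_diff Rats_mult) auto
      ultimately show False using irr by blast
    qed
    then have "real_of_int (l - l') * pi = real_of_int (6 * n) * pi" using n by (simp add: field_simps)
    then have "real_of_int (l - l') = real_of_int (6 * n)" by (metis mult_right_cancel pi_neq_zero)
    then have "l - l' = 6 * n" by linarith
    then have "even (l - l')" by simp
    then show ?thesis using kk by simp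
  qed
  \<comment> \<open>The value zero outside the countable group of directions is preserved by its rotations.\<close>
  define \<kappa> where
    "\<kappa> = (\<lambda>w. if \<exists>k l. w = dir k l then (THE v. \<exists>k l. w = dir k l \<and> v = val k l) else 0)"
  have \<kappa>_dir: "\<kappa> (dir k l) = val k l" for k l
  proof -
    have "(THE v. \<exists>k' l'. dir k l = dir k' l' \<and> v = val k' l') = val k l"
    proof (rule the_equality)
      fix v assume "\<exists>k' l'. dir k l = dir k' l' \<and> v = val k' l'"
      then obtain k' l' where "dir k l = dir k' l'" "v = val k' l'" by blast
      then show "v = val k l" using dir_eq[of k l k' l'] by (auto simp: val_def)
    qed blast
    then show ?thesis by (auto simp: \<kappa>_def)
  qed
  have \<kappa>_shift: "\<kappa> (w * dir a b) = val a b * \<kappa> w" for w a b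
  proof (cases "\<exists>k l. w = dir k l")
    case True
    then obtain k l where w: "w = dir k l" by blast
    have "w * dir a b = dir (k + a) (l + b)" by (simp add: w dir_def cis_mult algebra_simps add_divide_distrib)
    then show ?thesis using \<epsilon> by (auto simp: w \<kappa>_dir val_def)
  next
    case False
    have "\<not> (\<exists>k l. w * dir a b = dir k l)"
    proof
      assume "\<exists>k l. w * dir a b = dir k l"
      then obtain k l where "w * dir a b = dir k l" by blast
      then have "w = dir k l / dir a b" by (simp add: dir_def field_simps)
      also have "\<dots> = dir (k - a) (l - b)" by (simp add: dir_def cis_divide algebra_simps diff_divide_distrib)
      finally show False using False by blast
    qed
    then show ?thesis using False by (simp add: \<kappa>_def)
  qed
  have dirs: "dir 1 0 = cis \<alpha>" "dir 0 1 = cis (pi / 3)" "dir 0 3 = - 1" "dir 0 0 = 1"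
    by (simp_all add: dir_def)
  have vals: "val 1 0 = \<epsilon>" "val 0 1 = - 1" "val 0 3 = - 1" "val 0 0 = 1"
    by (simp_all add: val_def)
  define \<psi> where "\<psi> = (\<lambda>z. norm z * \<kappa> (sgn z))"
  have sgn_cis: "sgn (cis t) = cis t" for t by (simp add: sgn_div_norm)
  have shift: "\<psi> (z * dir a b) = val a b * \<psi> z" for z a b
    using \<kappa>_shift[of "sgn z" a b] by (simp add: \<psi>_def sgn_mult norm_mult dir_def sgn_cis)
  show ?thesis
  proof (rule that, unfold_locales)
    show "\<psi> (of_real x * z) = x * \<psi> z" for x z
    proof -
      have "sgn (complex_of_real x) = of_real (sgn x)" by (rule sgn_of_real)
      then have "\<kappa> (sgn (of_real x) * sgn z) = sgn x * \<kappa> (sgn z) \<or> x = 0"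
        using \<kappa>_shift[of "sgn z" 0 3] by (cases x "0::real" rule: linorder_cases) (auto simp: dirs vals)
      then show ?thesis
        by (auto simp: \<psi>_def sgn_mult norm_mult abs_sgn)
    qed
    show "\<psi> 1 = 1" using \<kappa>_dir[of 0 0] by (simp add: \<psi>_def dirs vals)
    show "\<psi> (z * cis \<alpha>) = \<epsilon> * \<psi> z" for z using shift[of z 1 0] by (simp add: dirs vals)
    show "\<psi> (z * cis (pi / 3)) = - \<psi> z" for z using shift[of z 0 1] by (simp add: dirs vals)
    show "\<psi> z \<in> {norm z, 0, - norm z}" for z
    proof -
      have "\<kappa> w \<in> {1, 0, - 1}" for w
      proof (cases "\<exists>k l. w = dir k l")
        case True
        then obtain k l where "w = dir k l" by blast
        then have "\<kappa> w = val k l" by (simp only: \<kappa>_dir)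
        then show ?thesis using \<epsilon> by (auto simp: val_def)
      qed (simp add: \<kappa>_def)
      from this[of "sgn z"] show ?thesis by (auto simp: \<psi>_def)
    qed
  qed (rule \<epsilon>)
qed

section \<open>Angles, rotations and congruent triangles\<close>

lemma inner_eq_dist: "(a - b) \<bullet> (c - b) = ((dist a b)\<^sup>2 + (dist c b)\<^sup>2 - (dist a c)\<^sup>2) / 2"
  for a b c :: complex
  using dot_norm_neg[of "a - b" "c - b"] by (simp add: dist_norm)

lemma cos_angle:
  assumes "a \<noteq> b" "c \<noteq> b"
  shows "cos (angle a b c) = ((a - b) \<bullet> (c - b)) / (dist a b * dist c b)"
proof -
  have "\<bar>(a - b) \<bullet> (c - b)\<bar> \<le> norm (a - b) * norm (c - b)" by (rule Cauchy_Schwarz_ineq2)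
  then have "\<bar>((a - b) \<bullet> (c - b)) / (norm (a - b) * norm (c - b))\<bar> \<le> 1"
    using assms by (simp add: divide_le_eq_1)
  then show ?thesis unfolding angle_def dist_norm by (intro cos_arccos_abs)
qed

lemma angle_bounds: "a \<noteq> b \<Longrightarrow> c \<noteq> b \<Longrightarrow> 0 \<le> angle a b c \<and> angle a b c \<le> pi"
proof -
  assume "a \<noteq> b" "c \<noteq> b"
  moreover have "\<bar>(a - b) \<bullet> (c - b)\<bar> \<le> norm (a - b) * norm (c - b)" by (rule Cauchy_Schwarz_ineq2)
  ultimately have "\<bar>((a - b) \<bullet> (c - b)) / (norm (a - b) * norm (c - b))\<bar> \<le> 1"
    by (simp add: divide_le_eq_1)
  from abs_le_D1[OF this] abs_le_D2[OF this] show ?thesis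
    unfolding angle_def by (intro arccos_bounded) linarith+
qed

lemma angle_eq_by_dist:
  assumes "dist a b = dist a' b'" "dist c b = dist c' b'" "dist a c = dist a' c'"
  shows "angle a b c = angle a' b' c'"
  using assms by (simp add: angle_def inner_eq_dist flip: dist_norm)

text \<open>The angle is unoriented, so the sense of the rotation remains open.\<close>

lemma side_by_rotation:
  assumes "a \<noteq> b" "c \<noteq> b"
  obtains \<sigma> :: real where "\<sigma> = 1 \<or> \<sigma> = - 1"
    "c - b = of_real (dist c b / dist a b) * ((a - b) * cis (\<sigma> * angle a b c))"
proof -
  define s where "s = dist c b / dist a b"
  have s: "s > 0" using assms by (simp add: s_def)
  define z where "z = (c - b) / (of_real s * (a - b))"
  have "norm z = 1"
    using assms by (simp add: z_def s_def norm_divide norm_mult dist_norm)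
  have "Re z = cos (angle a b c)"
  proof -
    have "Re ((c - b) / (a - b)) = ((a - b) \<bullet> (c - b)) / (dist a b)\<^sup>2"
      by (simp add: Re_divide inner_complex_def dist_norm cmod_power2 mult.commute)
    then have "Re z = ((a - b) \<bullet> (c - b)) / (dist a b)\<^sup>2 / s"
      by (simp add: z_def mult.commute[of "of_real s"] flip: divide_divide_eq_left)
    then show ?thesis
      using assms by (simp add: cos_angle s_def power2_eq_square)
  qed
  have "(Im z)\<^sup>2 = (sin (angle a b c))\<^sup>2"
    using cmod_power2[of z] sin_cos_squared_add[of "angle a b c"]
    unfolding \<open>norm z = 1\<close> \<open>Re z = cos (angle a b c)\<close> power_one by linarith
  then have "Im z = sin (angle a b c) \<or> Im z = - sin (angle a b c)" by (simp add: power2_eq_iff)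
  then have "z = cis (1 * angle a b c) \<or> z = cis (- 1 * angle a b c)"
    using \<open>Re z = cos (angle a b c)\<close> by (auto simp: complex_eq_iff)
  then obtain \<sigma> :: real where \<sigma>: "\<sigma> = 1 \<or> \<sigma> = - 1" "z = cis (\<sigma> * angle a b c)"
    by blast
  have "c - b = of_real s * (a - b) * z" using assms s by (simp add: z_def)
  with \<sigma> show ?thesis using that by (simp add: s_def mult.assoc)
qed

text \<open>An isometry of the plane is affine, so it maps the hull of three points to the hull of their
  images.\<close>

lemma congruent_triangle:
  assumes "congruent_figures (convex hull {P, Q, R}) t"
  obtains p q r where "t = convex hull {p, q, r}"
    "dist p q = dist P Q" "dist q r = dist Q R" "dist r p = dist R P"
proof -
  from assms obtain f where f: "\<And>x y. dist (f x) (f y) = dist x y"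
    and t: "f ` (convex hull {P, Q, R}) = t" by (auto simp: congruent_figures_def)
  define g where "g = (\<lambda>x. f x - f 0)"
  have "linear g"
    by (rule isometry_linear) (simp_all add: g_def dist_norm f[unfolded dist_norm])
  then have "g ` (convex hull {P, Q, R}) = convex hull {g P, g Q, g R}"
    by (simp add: convex_hull_linear_image)
  moreover have "f = (\<lambda>x. f 0 + x) \<circ> g" by (auto simp: g_def)
  ultimately have "t = (\<lambda>x. f 0 + x) ` (convex hull {g P, g Q, g R})" by (metis image_comp t)
  also have "\<dots> = convex hull {f P, f Q, f R}"
    by (simp add: g_def flip: convex_hull_translation)
  finally show ?thesis using that f by blast
qed

section \<open>The sides of a tile\<close>

text \<open>This is the closing condition of a triangle with sides \<open>a\<close>, \<open>b\<close>, \<open>c\<close> whose exterior angle between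
  \<open>a\<close> and \<open>b\<close> is \<open>\<pi>/3\<close>; \<open>\<sigma>\<close> is its orientation.\<close>

lemma obtuse_corner_rotation:
  assumes cos: "c * cos \<alpha> = b + a / 2" and sin: "c * sin \<alpha> = a * sqrt 3 / 2"
    and c: "c\<^sup>2 = a\<^sup>2 + b\<^sup>2 + a * b" and \<sigma>: "\<sigma> = 1 \<or> \<sigma> = - 1"
  shows "of_real c = cis (\<sigma> * \<alpha>) * (of_real b + of_real a * cis (- \<sigma> * (pi / 3)))"
proof -
  have "cis (- \<sigma> * \<alpha>) * of_real c = of_real b + of_real a * cis (- \<sigma> * (pi / 3))"
    using \<sigma> cos sin by (auto simp: complex_eq_iff cos_60 sin_60 mult.commute[of _ c])
  note * = this
  have "of_real c = cis (\<sigma> * \<alpha>) * (cis (- \<sigma> * \<alpha>) * of_real c)"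
    by (simp add: cis_mult flip: mult.assoc)
  then show ?thesis unfolding * .
qed

lemma wedge_rotate: "wedge u (of_real k * (u * cis \<theta>)) = k * (norm u)\<^sup>2 * sin \<theta>"
  unfolding wedge_def cmod_power2 by (simp add: algebra_simps power2_eq_square)

text \<open>Relative to the side \<open>pq\<close>, the other two sides have directions in the group generated by \<open>\<alpha>\<close> and
  \<open>\<pi>/3\<close>, with the same sign \<open>\<sigma>\<close> in both; obtaining the side \<open>qr\<close> by subtraction keeps these signs
  consistent.\<close>

lemma tile_edges:
  fixes p q r :: complex
  assumes pos: "a > 0" "b > 0" "c > 0"
    and d: "dist p q = c" "dist q r = a" "dist r p = b"
    and ang: "angle q p r = \<alpha>"
    and cos: "c * cos \<alpha> = b + a / 2" and sin: "c * sin \<alpha> = a * sqrt 3 / 2"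
    and c: "c\<^sup>2 = a\<^sup>2 + b\<^sup>2 + a * b"
  obtains \<sigma> :: real where "\<sigma> = 1 \<or> \<sigma> = - 1"
    "r - p = of_real (b / c) * ((q - p) * cis (\<sigma> * \<alpha>))"
    "r - q = of_real (- (a / c)) * ((q - p) * cis (\<sigma> * \<alpha>) * cis (- \<sigma> * (pi / 3)))"
    "\<bar>wedge (q - p) (r - p)\<bar> = a * b * (sqrt 3 / 2)"
proof -
  have "q \<noteq> p" "r \<noteq> p" using pos d by auto
  then obtain \<sigma> :: real where \<sigma>: "\<sigma> = 1 \<or> \<sigma> = - 1"
    and rp: "r - p = of_real (b / c) * ((q - p) * cis (\<sigma> * \<alpha>))"
    using side_by_rotation[of q p r] d ang by (auto simp: dist_commute)
  have "of_real c * (r - q) = of_real c * (r - p) - (q - p) * of_real c"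
    by (simp add: algebra_simps)
  also have "of_real c * (r - p) = of_real b * ((q - p) * cis (\<sigma> * \<alpha>))"
    unfolding rp using pos by simp
  also have "of_real b * ((q - p) * cis (\<sigma> * \<alpha>)) - (q - p) * of_real c
      = - of_real a * ((q - p) * cis (\<sigma> * \<alpha>) * cis (- \<sigma> * (pi / 3)))"
    unfolding obtuse_corner_rotation[OF cos sin c \<sigma>] by (simp add: algebra_simps)
  finally have "r - q = - of_real a * ((q - p) * cis (\<sigma> * \<alpha>) * cis (- \<sigma> * (pi / 3))) / of_real c"
    using pos by (simp add: field_simps)
  then have rq: "r - q = of_real (- (a / c)) * ((q - p) * cis (\<sigma> * \<alpha>) * cis (- \<sigma> * (pi / 3)))"
    by simp
  have "norm (q - p) = c" using d(1) by (metis dist_commute dist_norm)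
  then have "wedge (q - p) (r - p) = b * (c * sin (\<sigma> * \<alpha>))"
    unfolding rp wedge_rotate using pos by (simp add: power2_eq_square)
  also have "\<dots> = \<sigma> * (a * b * (sqrt 3 / 2))" using \<sigma> sin by auto
  finally have w: "wedge (q - p) (r - p) = \<sigma> * (a * b * (sqrt 3 / 2))" .
  have "a * b * (sqrt 3 / 2) > 0" using pos by simp
  from abs_of_pos[OF this] have "\<bar>wedge (q - p) (r - p)\<bar> = a * b * (sqrt 3 / 2)"
    unfolding w using \<sigma> by auto
  then show ?thesis using that \<sigma> rp rq by blast
qed

section \<open>From the counting equations to rationality\<close>

text \<open>The factors \<open>c + (a - b)\<close> and \<open>c - (a - b)\<close> have product \<open>3 a b\<close>. Multiplying each counting equation
  by the conjugate factor turns it into a formula for \<open>n\<close> or \<open>m\<close> in which \<open>c - (a + b)\<close> and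
  \<open>c + (a + b)\<close> appear; these have product \<open>-a b\<close>. Sum and difference of the formulas determine
  \<open>c / (a + b)\<close>. The product \<open>n m\<close> and the area equation have \<open>X\<^sup>2\<close> as a common factor and determine
  \<open>a / b\<close>.\<close>

lemma tile_ratios_rational:
  fixes a b c X Y :: real
  assumes pos: "a > 0" "b > 0" "c > 0" "X > 0"
    and c: "c\<^sup>2 = a\<^sup>2 + b\<^sup>2 + a * b" and Y: "Y * c = X * (2 * b + a)"
    and n: "n \<in> \<int>" "n * (c + (a - b)) = Y - 2 * X"
    and m: "m \<in> \<int>" "m * (c - (a - b)) = Y + 2 * X"
    and N: "N \<in> \<int>" "N * (b * c) = X * Y"
  shows "a / b \<in> \<rat>" "c / b \<in> \<rat>"
proof -
  have nq: "n \<in> \<rat>" "m \<in> \<rat>" "N \<in> \<rat>" using n m N Ints_subset_Rats by auto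
  have prod: "(c + (a - b)) * (c - (a - b)) = 3 * (a * b)"
    using c by (simp add: power2_eq_square algebra_simps)
  have "n * (3 * (a * b)) * c = n * (c + (a - b)) * c * (c - (a - b))"
    unfolding prod[symmetric] by (simp only: ac_simps)
  also have "\<dots> = (Y * c - 2 * X * c) * (c - (a - b))"
    unfolding n(2) by (simp add: algebra_simps)
  also have "\<dots> = X * ((2 * b + a - 2 * c) * (c - (a - b)))"
    unfolding Y by (simp add: algebra_simps)
  also have "(2 * b + a - 2 * c) * (c - (a - b)) = 3 * a * (c - a - b)"
    using c by (simp add: power2_eq_square algebra_simps)
  finally have "n * (b * c) = X * (c - a - b)" using pos by simp
  then have n': "n * b * c = X * (c - (a + b))" by (simp add: algebra_simps)
  have "m * (3 * (a * b)) * c = m * (c - (a - b)) * c * (c + (a - b))"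
    unfolding prod[symmetric] by (simp only: ac_simps)
  also have "\<dots> = (Y * c + 2 * X * c) * (c + (a - b))"
    unfolding m(2) by (simp add: algebra_simps)
  also have "\<dots> = X * ((2 * b + a + 2 * c) * (c + (a - b)))"
    unfolding Y by (simp add: algebra_simps)
  also have "(2 * b + a + 2 * c) * (c + (a - b)) = 3 * a * (c + (a + b))"
    using c by (simp add: power2_eq_square algebra_simps)
  finally have m': "m * b * c = X * (c + (a + b))" using pos by simp
  have N': "N * b * c\<^sup>2 = X\<^sup>2 * (2 * b + a)"
  proof -
    have "N * b * c\<^sup>2 = N * (b * c) * c" by (simp add: power2_eq_square)
    also have "\<dots> = X * (Y * c)" unfolding N(2) by simp
    finally show ?thesis unfolding Y by (simp add: power2_eq_square)
  qed
  have dif: "(m - n) * (b * c) = 2 * X * (a + b)" and sum: "(m + n) * (b * c) = 2 * X * c"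
    using n' m' by (simp_all add: algebra_simps)
  have mn0: "m - n > 0"
  proof -
    have "(m - n) * (b * c) > 0" unfolding dif using pos by simp
    moreover have "b * c > 0" using pos by simp
    ultimately show ?thesis by (rule zero_less_mult_pos2)
  qed
  have "c * (m - n) * (b * c) = c * (2 * X * (a + b))" unfolding dif[symmetric] by simp
  also have "\<dots> = (a + b) * (2 * X * c)" by simp
  also have "\<dots> = (a + b) * (m + n) * (b * c)" unfolding sum[symmetric] by simp
  finally have mn: "c * (m - n) = (a + b) * (m + n)" using pos by simp
  have nm: "(n * m) * b\<^sup>2 * c\<^sup>2 = - (X\<^sup>2 * (a * b))"
  proof -
    have "(n * m) * b\<^sup>2 * c\<^sup>2 = (n * b * c) * (m * b * c)" by (simp add: power2_eq_square)
    also have "\<dots> = X\<^sup>2 * ((c - (a + b)) * (c + (a + b)))"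
      unfolding n' m' by (simp add: power2_eq_square)
    also have "(c - (a + b)) * (c + (a + b)) = - (a * b)"
      using c by (simp add: power2_eq_square algebra_simps)
    finally show ?thesis by simp
  qed
  then have "((n * m) * b * c\<^sup>2) * b = - (X\<^sup>2 * a) * b"
    by (simp add: power2_eq_square mult.commute mult.left_commute)
  then have nm: "(n * m) * b * c\<^sup>2 = - (X\<^sup>2 * a)"
    using pos(2) by (metis mult_right_cancel order_less_irrefl)
  define M where "M = N + n * m"
  have M: "M * b * c\<^sup>2 = 2 * X\<^sup>2 * b" using N' nm by (simp add: M_def algebra_simps)
  then have M': "M * c\<^sup>2 = 2 * X\<^sup>2" using pos by simp
  have M0: "M > 0"
  proof -
    have "M * c\<^sup>2 > 0" unfolding M' using pos by simp
    then show ?thesis using pos by (simp add: zero_less_mult_iff)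
  qed
  have "M * a * c\<^sup>2 = M * c\<^sup>2 * a" by simp
  also have "\<dots> = - 2 * (n * m * b * c\<^sup>2)" unfolding M' nm by simp
  also have "\<dots> = - 2 * (n * m) * b * c\<^sup>2" by simp
  finally have "M * a = - 2 * (n * m) * b"
    using pos(3) by (metis mult_right_cancel order_less_irrefl power_not_zero)
  moreover have "a / b = (M * a) / (M * b)" using M0 by simp
  ultimately have "a / b = - 2 * (n * m) / M" using pos by simp
  then show ab: "a / b \<in> \<rat>" using nq by (simp add: M_def)
  have "c = (a + b) * (m + n) / (m - n)" using mn mn0 by (simp add: eq_divide_eq)
  then have "c / b = (a / b + 1) * ((m + n) / (m - n))"
    using pos mn0 by (simp add: divide_simps)
  then show "c / b \<in> \<rat>" using ab nq by simp
qed

section \<open>Rationality of the tile\<close>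

theorem theorem12p5:
  fixes A B C P Q R :: complex
    and \<alpha> \<beta> :: real
    and \<T> :: "complex set set"
  assumes "is_triangle A B C"
    and "dist A C = dist B C"
    and "\<not> equilateral A B C"
    and "angle B A C = \<alpha>" and "angle A B C = \<alpha>"
    and "is_triangle P Q R"
    and "angle Q P R = \<alpha>" and "angle P Q R = \<beta>" and "angle P R Q = 2 * pi / 3"
    and "\<not> (\<exists>q\<in>\<rat>. \<alpha> = q * pi)"
    and "tiling \<T> (convex hull {P, Q, R}) (convex hull {A, B, C})"
  shows "rational_triangle P Q R"
proof -
  define a b c X Y where "a = dist Q R" and "b = dist R P" and "c = dist P Q"
    and "X = dist A C" and "Y = dist A B"
  note defs = this
  have ABC: "\<not> collinear {A, B, C}" and PQR: "\<not> collinear {P, Q, R}"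
    using assms by (auto simp: is_triangle_def)
  then have ne: "A \<noteq> B" "A \<noteq> C" "P \<noteq> Q" "Q \<noteq> R" "R \<noteq> P" by (auto simp: insert_commute)
  then have pos: "a > 0" "b > 0" "c > 0" "X > 0" "Y > 0" by (auto simp: defs)
  have "(P - R) \<bullet> (Q - R) = - (a * b) / 2"
  proof -
    have "cos (2 * pi / 3) = ((P - R) \<bullet> (Q - R)) / (b * a)"
      using cos_angle[of P R Q] ne assms(9) by (simp add: defs dist_commute)
    then have "((P - R) \<bullet> (Q - R)) / (b * a) = - 1 / 2" by (simp add: cos_120)
    then show ?thesis using pos by (simp add: field_simps)
  qed
  then have c2: "c\<^sup>2 = a\<^sup>2 + b\<^sup>2 + a * b"
    unfolding inner_eq_dist by (simp add: defs dist_commute)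
  have cos\<alpha>: "c * cos \<alpha> = b + a / 2"
  proof -
    have "cos \<alpha> = ((Q - P) \<bullet> (R - P)) / (c * b)"
      using cos_angle[of Q P R] ne assms(7) by (simp add: defs dist_commute)
    also have "(Q - P) \<bullet> (R - P) = (c\<^sup>2 + b\<^sup>2 - a\<^sup>2) / 2"
      unfolding inner_eq_dist by (simp add: defs dist_commute)
    also have "\<dots> = b * (b + a / 2)" unfolding c2 by (simp add: power2_eq_square algebra_simps)
    finally show ?thesis using pos by simp
  qed
  have sin\<alpha>: "c * sin \<alpha> = a * sqrt 3 / 2"
  proof (rule power2_eq_imp_eq)
    have "(c * sin \<alpha>)\<^sup>2 = c\<^sup>2 - (c * cos \<alpha>)\<^sup>2"
      by (simp add: power_mult_distrib sin_squared_eq algebra_simps)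
    then show "(c * sin \<alpha>)\<^sup>2 = (a * sqrt 3 / 2)\<^sup>2"
      unfolding cos\<alpha> c2 by (simp add: power_mult_distrib power_divide power2_eq_square algebra_simps)
    show "0 \<le> c * sin \<alpha>"
      using angle_bounds[of Q P R] ne assms(7) pos by (auto intro!: mult_nonneg_nonneg sin_ge_zero)
  qed (use pos in simp)
  have Y2: "Y = 2 * (X * cos \<alpha>)"
  proof -
    have "cos \<alpha> = ((B - A) \<bullet> (C - A)) / (Y * X)"
      using cos_angle[of B A C] ne assms(4) by (simp add: defs dist_commute)
    also have "(B - A) \<bullet> (C - A) = Y\<^sup>2 / 2"
      unfolding inner_eq_dist using assms(2) by (simp add: defs dist_commute)
    finally show ?thesis using pos by (simp add: power2_eq_square field_simps)
  qed
  then have Yc: "Y * c = X * (2 * b + a)" using cos\<alpha> by (simp add: mult.commute[of _ c] mult.left_commute[of _ c])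
  obtain \<tau> :: real where \<tau>: "\<tau> = 1 \<or> \<tau> = - 1"
    and CA: "C - A = of_real (X / Y) * ((B - A) * cis (\<tau> * \<alpha>))"
    using side_by_rotation[of B A C] ne assms(4) by (auto simp: defs dist_commute)
  have CB: "C - B = of_real (- (X / Y)) * ((B - A) * cis (- \<tau> * \<alpha>))"
  proof -
    have "cis (\<tau> * \<alpha>) + cis (- \<tau> * \<alpha>) = of_real (Y / X)"
      using \<tau> pos Y2 by (auto simp: complex_eq_iff)
    then have "of_real (X / Y) * ((B - A) * (cis (\<tau> * \<alpha>) + cis (- \<tau> * \<alpha>))) = B - A"
      using pos by simp
    then have "of_real (X / Y) * ((B - A) * cis (\<tau> * \<alpha>))
        + of_real (X / Y) * ((B - A) * cis (- \<tau> * \<alpha>)) = B - A"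
      by (simp only: distrib_left)
    note sum = this[folded CA]
    have "C - B = - s" if "(C - A) + s = B - A" for s
    proof -
      have "C - B = ((C - A) + s) - (B - A) - s" by simp
      then show ?thesis using that by simp
    qed
    from this[OF sum] show ?thesis by simp
  qed
  have areaABC: "\<bar>wedge (B - A) (C - A)\<bar> = X * Y * (a * sqrt 3 / 2) / c"
  proof -
    have "norm (B - A) = Y" by (metis Y_def dist_commute dist_norm)
    then have "wedge (B - A) (C - A) = X * Y * sin (\<tau> * \<alpha>)"
      unfolding CA wedge_rotate using pos by (simp add: power2_eq_square)
    also have "\<dots> = \<tau> * (X * Y * (c * sin \<alpha>) / c)" using \<tau> pos by auto
    finally show ?thesis unfolding sin\<alpha> using \<tau> pos by (auto simp: abs_mult)
  qed
  have fin: "finite \<T>" and cong: "\<And>t. t \<in> \<T> \<Longrightarrow> congruent_figures (convex hull {P, Q, R}) t"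
    and dis: "pairwise (\<lambda>s t. interior s \<inter> interior t = {}) \<T>"
    and un: "\<Union>\<T> = convex hull {A, B, C}"
    using assms(11) by (auto simp: tiling_def)
  have "\<exists>p q r. t = convex hull {p, q, r} \<and> dist p q = c \<and> dist q r = a \<and> dist r p = b" if "t \<in> \<T>" for t
    by (rule congruent_triangle[OF cong[OF that]]) (use defs(1-3) in blast)
  then have "\<forall>t\<in>\<T>. \<exists>p q r. t = convex hull {p, q, r} \<and> dist p q = c \<and> dist q r = a \<and> dist r p = b"
    by blast
  from bchoice[OF this] obtain p where "\<forall>t\<in>\<T>. \<exists>q r. t = convex hull {p t, q, r} \<and>
      dist (p t) q = c \<and> dist q r = a \<and> dist r (p t) = b" ..
  from bchoice[OF this] obtain q where "\<forall>t\<in>\<T>. \<exists>r. t = convex hull {p t, q t, r} \<and>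
      dist (p t) (q t) = c \<and> dist (q t) r = a \<and> dist r (p t) = b" ..
  from bchoice[OF this] obtain r where r: "\<forall>t\<in>\<T>. t = convex hull {p t, q t, r t} \<and>
      dist (p t) (q t) = c \<and> dist (q t) (r t) = a \<and> dist (r t) (p t) = b" ..
  have t: "t = convex hull {p t, q t, r t}" if "t \<in> \<T>" for t using r that by blast
  have d: "dist (p t) (q t) = c" "dist (q t) (r t) = a" "dist (r t) (p t) = b" if "t \<in> \<T>" for t
    using r that by blast+
  have ang: "angle (q t) (p t) (r t) = \<alpha>" if "t \<in> \<T>" for t
    using angle_eq_by_dist[of "q t" "p t" Q P "r t" R] d[OF that] assms(7) by (simp add: defs dist_commute)
  note edges = tile_edges[OF pos(1-3) d ang cos\<alpha> sin\<alpha> c2]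
  have area: "\<bar>wedge (q t - p t) (r t - p t)\<bar> = a * b * (sqrt 3 / 2)" if "t \<in> \<T>" for t
    by (rule edges[OF that that that that])
  have nc: "\<not> collinear {p t, q t, r t}" if "t \<in> \<T>" for t
    using area[OF that] pos by (auto simp: collinear_iff_wedge)
  have disj: "interior (convex hull {p s, q s, r s}) \<inter> interior (convex hull {p t, q t, r t}) = {}"
    if "s \<in> \<T>" "t \<in> \<T>" "s \<noteq> t" for s t
    using dis that by (simp add: pairwise_def flip: t)
  have union: "(\<Union>s\<in>\<T>. convex hull {p s, q s, r s}) = convex hull {A, B, C}"
    using un by (simp flip: t)
  have N: "real (card \<T>) * (b * c) = X * Y"
  proof -
    have "(\<Sum>t\<in>\<T>. \<bar>wedge (q t - p t) (r t - p t)\<bar>) = \<bar>wedge (B - A) (C - A)\<bar>"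
      by (rule sum_area_additive[OF fin nc ABC disj union])
    then have "real (card \<T>) * (a * b * (sqrt 3 / 2)) = X * Y * (a * sqrt 3 / 2) / c"
      by (simp add: area areaABC)
    then have "real (card \<T>) * (b * c) * (a * (sqrt 3 / 2)) = X * Y * (a * (sqrt 3 / 2))"
      using pos by (simp add: field_simps)
    then show ?thesis using pos by (subst (asm) mult_right_cancel) auto
  qed
  \<comment> \<open>The integer is a signed number of tiles: orientation times the sign of the direction of \<open>pq\<close>.\<close>
  have signed_count: "\<exists>n\<in>\<int>. n * (c + \<epsilon> * (a - b)) = Y - 2 * \<epsilon> * X" if \<epsilon>: "\<epsilon> = 1 \<or> \<epsilon> = - 1" for \<epsilon> :: real
  proof -
    obtain \<psi> where "sign_character \<psi> \<alpha> \<epsilon>"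
      by (rule exists_sign_character[OF assms(10) \<epsilon>])
    then interpret sign_character \<psi> \<alpha> \<epsilon> .
    \<comment> \<open>Directions are measured from the base, so that \<open>AB\<close> has the direction with sign \<open>1\<close>.\<close>
    define \<psi>' where "\<psi>' = (\<lambda>z. \<psi> (z / (B - A)))"
    let ?E = "edge_sum (\<lambda>z w. \<psi>' (w - z))"
    have hom': "\<psi>' (of_real x * z) = x * \<psi>' z" for x z
      using hom[of x "z / (B - A)"] by (simp add: \<psi>'_def)
    have minus': "\<psi>' (- z) = - \<psi>' z" for z using minus[of "z / (B - A)"] by (simp add: \<psi>'_def)
    have rot: "\<psi>' (z * cis (\<sigma> * \<alpha>)) = \<epsilon> * \<psi>' z" "\<psi>' (z * cis (\<sigma> * (pi / 3))) = - \<psi>' z"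
      if "\<sigma> = 1 \<or> \<sigma> = - 1" for z \<sigma>
      using rotate_alpha[OF that, of "z / (B - A)"] rotate_third[OF that, of "z / (B - A)"]
      by (simp_all add: \<psi>'_def)
    have tile: "\<exists>n\<in>\<int>. ?E (p t) (q t) (r t) = n * ((c + \<epsilon> * (a - b)) / Y)" if tT: "t \<in> \<T>" for t
    proof -
      obtain \<sigma> :: real where \<sigma>: "\<sigma> = 1 \<or> \<sigma> = - 1"
        and rp: "r t - p t = of_real (b / c) * ((q t - p t) * cis (\<sigma> * \<alpha>))"
        and rq: "r t - q t = of_real (- (a / c)) * ((q t - p t) * cis (\<sigma> * \<alpha>) * cis (- \<sigma> * (pi / 3)))"
        by (rule edges[OF tT tT tT tT])
      have m\<sigma>: "- \<sigma> = 1 \<or> - \<sigma> = - 1" using \<sigma> by auto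
      define e where "e = \<psi>' (q t - p t)"
      have 1: "\<psi>' (r t - q t) = a / c * (\<epsilon> * e)"
        unfolding rq hom' rot(2)[OF m\<sigma>] rot(1)[OF \<sigma>] e_def by simp
      have "\<psi>' (p t - r t) = - \<psi>' (r t - p t)" using minus'[of "r t - p t"] by simp
      also have "\<dots> = - (b / c * (\<epsilon> * e))" unfolding rp hom' rot(1)[OF \<sigma>] e_def by simp
      finally have 2: "\<psi>' (p t - r t) = - (b / c * (\<epsilon> * e))" .
      have sum: "e + a / c * (\<epsilon> * e) + - (b / c * (\<epsilon> * e)) = (e / c) * (c + \<epsilon> * (a - b))"
        using pos by (simp add: field_simps)
      have "norm ((q t - p t) / (B - A)) = c / Y"
        using d(1)[OF tT] by (simp add: norm_divide defs dist_norm norm_minus_commute)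
      then have "e / c * Y \<in> \<int>"
        using val[of "(q t - p t) / (B - A)"] pos by (auto simp: e_def \<psi>'_def)
      moreover have "sgn (wedge (q t - p t) (r t - p t)) \<in> \<int>" by (auto simp: sgn_if)
      ultimately have "sgn (wedge (q t - p t) (r t - p t)) * (e / c * Y) \<in> \<int>" by (rule Ints_mult[rotated])
      moreover have "?E (p t) (q t) (r t)
          = sgn (wedge (q t - p t) (r t - p t)) * (e / c * Y) * ((c + \<epsilon> * (a - b)) / Y)"
        unfolding edge_sum_def 1 2 using sum pos by (simp flip: e_def)
      ultimately show ?thesis by blast
    qed
    then obtain n where n: "\<And>t. t \<in> \<T> \<Longrightarrow> n t \<in> \<int>"
      "\<And>t. t \<in> \<T> \<Longrightarrow> ?E (p t) (q t) (r t) = n t * ((c + \<epsilon> * (a - b)) / Y)"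
      unfolding Bex_def by metis
    \<comment> \<open>The three sides of the large triangle have the directions \<open>0\<close>, \<open>\<pi> - \<tau> \<alpha>\<close> and \<open>\<pi> + \<tau> \<alpha>\<close>.\<close>
    define s where "s = sgn (wedge (B - A) (C - A))"
    have s: "s = 1 \<or> s = - 1" using ABC by (auto simp: s_def collinear_iff_wedge sgn_if)
    have m\<tau>: "- \<tau> = 1 \<or> - \<tau> = - 1" using \<tau> by auto
    have one': "\<psi>' (B - A) = 1" using one ne by (simp add: \<psi>'_def)
    have "\<psi>' (A - C) = - \<psi>' (C - A)" using minus'[of "C - A"] by simp
    also have "\<dots> = - (X / Y * \<epsilon>)" unfolding CA hom' rot(1)[OF \<tau>] one' by simp
    finally have AC: "\<psi>' (A - C) = - (X / Y * \<epsilon>)" .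
    have CB': "\<psi>' (C - B) = - (X / Y * \<epsilon>)" unfolding CB hom' rot(1)[OF m\<tau>] one' by simp
    have "(\<Sum>t\<in>\<T>. ?E (p t) (q t) (r t)) = ?E A B C"
      by (rule homogeneous_edge_sum_additive[OF fin nc ABC disj union hom'])
    then have "(\<Sum>t\<in>\<T>. n t) * ((c + \<epsilon> * (a - b)) / Y) = ?E A B C"
      by (simp add: n(2) sum_distrib_right sum_divide_distrib)
    also have "\<dots> = s * ((Y - 2 * \<epsilon> * X) / Y)"
      unfolding edge_sum_def s_def[symmetric] one' AC CB' using pos by (simp add: field_simps)
    finally have eq: "(\<Sum>t\<in>\<T>. n t) * (c + \<epsilon> * (a - b)) = s * (Y - 2 * \<epsilon> * X)"
      using pos by (simp add: field_simps)
    have "s * (\<Sum>t\<in>\<T>. n t) \<in> \<int>" using s n(1) by (auto intro!: Ints_mult Ints_sum)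
    moreover have "s * (\<Sum>t\<in>\<T>. n t) * (c + \<epsilon> * (a - b)) = Y - 2 * \<epsilon> * X"
      using s unfolding mult.assoc eq by auto
    ultimately show ?thesis by blast
  qed
  obtain n where n: "n \<in> \<int>" "n * (c + (a - b)) = Y - 2 * X" using signed_count[of 1] by auto
  obtain m where m: "m \<in> \<int>" "m * (c - (a - b)) = Y + 2 * X" using signed_count[of "- 1"] by (auto simp: diff_diff_eq2 add_diff_eq)
  have "real (card \<T>) \<in> \<int>" by simp
  note rat = tile_ratios_rational[OF pos(1-4) c2 Yc n m this N]
  have "x / y \<in> \<rat>" if "x / b \<in> \<rat>" "y / b \<in> \<rat>" for x y
  proof -
    have "(x / b) / (y / b) \<in> \<rat>" using that by (rule Rats_divide)
    then show ?thesis using pos by simp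
  qed
  moreover have "x / b \<in> \<rat>" if "x \<in> side_lengths P Q R" for x
    using that rat pos by (auto simp: side_lengths_def defs(1-3)[symmetric])
  ultimately show ?thesis by (simp add: rational_triangle_def)
qed

end
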